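(* For all $\lambda$-terms $t,s$: if $t\to_{\beta_v}^* s$ and $s$ is $\to_w$-normal, then $t$ is strongly $\to_w$-normalizing (there is no infinite $\to_w$-sequence from $t$).
   Context: $\lambda$-terms: $t,s::=x\mid\lambda x.t\mid ts$ (up to $\alpha$-equivalence); values $v::=x\mid\lambda x.t$; $t\{x:=s\}$ is capture-avoiding substitution. $\to_{\beta_v}$ is the closure of $(\lambda x.t)v\to_{\beta_v}t\{x:=v\}$ ($v$ a value) under abstraction and both sides of application; $\to_{\beta_v}^*$ its reflexive-transitive closure. Weak call-by-value reduction $\to_w$: $(\lambda x.t)v\to_w t\{x:=v\}$ for $v$ a value; if $t\to_w t'$ then $ts\to_w t's$ and $st\to_w st'$. A term is $\to_w$-normal if it has no $\to_w$-step. *)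

theory Defs
  imports Main
begin

(* Lambda-terms up to alpha-equivalence, in de Bruijn representation: an index pointing
   beyond all enclosing abstractions denotes a free variable. *)
datatype lterm =
    Var nat
  | Lam lterm
  | App lterm lterm

fun is_value :: "lterm \<Rightarrow> bool" where
  "is_value (Var i) = True"
| "is_value (Lam t) = True"
| "is_value (App t s) = False"

(* Increments every index of the term that is free relative to k enclosing binders. *)
fun lift :: "nat \<Rightarrow> lterm \<Rightarrow> lterm" where
  "lift k (Var i) = (if i < k then Var i else Var (Suc i))"
| "lift k (Lam t) = Lam (lift (Suc k) t)"
| "lift k (App t s) = App (lift k t) (lift k s)"

(* subst k u t replaces index k by u in t and removes the binder of k, so that indices
   above k are decremented; the contractum of App (Lam t) v is subst 0 v t. *)
fun subst :: "nat \<Rightarrow> lterm \<Rightarrow> lterm \<Rightarrow> lterm" where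
  "subst k u (Var i) = (if i < k then Var i else if i = k then u else Var (i - 1))"
| "subst k u (Lam t) = Lam (subst (Suc k) (lift 0 u) t)"
| "subst k u (App t s) = App (subst k u t) (subst k u s)"

inductive betav :: "lterm \<Rightarrow> lterm \<Rightarrow> bool" (infix "\<rightarrow>\<^sub>\<beta>\<^sub>v" 50) where
  betav_root: "is_value v \<Longrightarrow> App (Lam t) v \<rightarrow>\<^sub>\<beta>\<^sub>v subst 0 v t"
| betav_Lam: "t \<rightarrow>\<^sub>\<beta>\<^sub>v t' \<Longrightarrow> Lam t \<rightarrow>\<^sub>\<beta>\<^sub>v Lam t'"
| betav_AppL: "t \<rightarrow>\<^sub>\<beta>\<^sub>v t' \<Longrightarrow> App t s \<rightarrow>\<^sub>\<beta>\<^sub>v App t' s"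
| betav_AppR: "t \<rightarrow>\<^sub>\<beta>\<^sub>v t' \<Longrightarrow> App s t \<rightarrow>\<^sub>\<beta>\<^sub>v App s t'"

inductive weak :: "lterm \<Rightarrow> lterm \<Rightarrow> bool" (infix "\<rightarrow>\<^sub>w" 50) where
  weak_root: "is_value v \<Longrightarrow> App (Lam t) v \<rightarrow>\<^sub>w subst 0 v t"
| weak_AppL: "t \<rightarrow>\<^sub>w t' \<Longrightarrow> App t s \<rightarrow>\<^sub>w App t' s"
| weak_AppR: "t \<rightarrow>\<^sub>w t' \<Longrightarrow> App s t \<rightarrow>\<^sub>w App s t'"

definition normal :: "('a \<Rightarrow> 'a \<Rightarrow> bool) \<Rightarrow> 'a \<Rightarrow> bool" where
  "normal R t \<longleftrightarrow> (\<nexists>t'. R t t')"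

definition strongly_normalizing :: "('a \<Rightarrow> 'a \<Rightarrow> bool) \<Rightarrow> 'a \<Rightarrow> bool" where
  "strongly_normalizing R t \<longleftrightarrow> (\<nexists>f :: nat \<Rightarrow> 'a. f 0 = t \<and> (\<forall>i. R (f i) (f (Suc i))))"

end

theory Submission imports Defs begin

text \<open>
  Weak reduction has the one-step diamond property, because distinct weak redexes of a term are
  disjoint (values are weakly normal). Hence all maximal weak reductions from a term have the
  same length, and it suffices that the term reaches some weakly normal form. This property is
  pulled back along a single \<open>\<beta>\<^sub>v\<close>-step: a parallel \<open>\<beta>\<^sub>v\<close>-step splits into weak steps followed by a
  parallel step acting only under abstractions, and such internal steps can be postponed after
  weak ones and reflect weak normality.
\<close>

section \<open>Lifting and substitution of de Bruijn indices\<close>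

lemma lift_lift:
  "i \<le> k \<Longrightarrow> lift (Suc k) (lift i t) = lift i (lift k t)"
  by (induction t arbitrary: i k) auto

lemma lift_subst_le:
  "j \<le> i \<Longrightarrow> lift i (subst j u t) = subst j (lift i u) (lift (Suc i) t)"
  by (induction t arbitrary: i j u) (auto simp: lift_lift)

lemma lift_subst_ge:
  "i \<le> j \<Longrightarrow> lift i (subst j u t) = subst (Suc j) (lift i u) (lift i t)"
  by (induction t arbitrary: i j u) (auto simp: lift_lift)

lemma subst_lift: "subst k u (lift k t) = t"
  by (induction t arbitrary: k u) auto

text \<open>The substitution lemma in de Bruijn form: before index \<open>i\<close> is removed,
  index \<open>j\<close> is still numbered \<open>Suc j\<close>.\<close>

lemma subst_subst:
  "i \<le> j \<Longrightarrow> subst j v (subst i u t) = subst i (subst j v u) (subst (Suc j) (lift i v) t)"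
  by (induction t arbitrary: i j u v)
    (auto simp: lift_lift [symmetric] lift_subst_ge subst_lift split: if_splits)

lemma is_value_lift: "is_value v \<Longrightarrow> is_value (lift k v)"
  by (cases v) auto

lemma is_value_subst: "is_value v \<Longrightarrow> is_value u \<Longrightarrow> is_value (subst k u v)"
  by (cases v) auto

section \<open>Confluence and termination of weak reduction\<close>

inductive_cases weak_VarE: "Var i \<rightarrow>\<^sub>w s"
inductive_cases weak_LamE: "Lam t \<rightarrow>\<^sub>w s"
inductive_cases weak_AppE: "App t u \<rightarrow>\<^sub>w s"

lemma value_not_weak: "is_value v \<Longrightarrow> \<not> v \<rightarrow>\<^sub>w s"
  by (cases v) (auto elim: weak_VarE weak_LamE)

text \<open>Neither the abstraction nor the argument of a contracted redex can step, since both are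
  values. Otherwise, steps on different sides of an application commute, and steps on the same side
  are joined by induction.\<close>

lemma weak_diamond:
  "t \<rightarrow>\<^sub>w a \<Longrightarrow> t \<rightarrow>\<^sub>w b \<Longrightarrow> a = b \<or> (\<exists>c. a \<rightarrow>\<^sub>w c \<and> b \<rightarrow>\<^sub>w c)"
proof (induction arbitrary: b rule: weak.induct)
  case (weak_root v t)
  then show ?case by (auto elim!: weak_AppE weak_LamE dest: value_not_weak)
next
  case (weak_AppL t t' s)
  note IH = weak_AppL.IH and step = weak_AppL.hyps
  from weak_AppL.prems show ?case
  proof cases
    case weak_root
    with step show ?thesis by (auto elim: weak_LamE)
  next
    case (weak_AppL t'')
    with IH [of t''] show ?thesis by (auto intro: weak.intros)
  next
    case (weak_AppR s')
    with step show ?thesis by (auto intro: weak.intros)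
  qed
next
  case (weak_AppR t t' s)
  note IH = weak_AppR.IH and step = weak_AppR.hyps
  from weak_AppR.prems show ?case
  proof cases
    case weak_root
    with step show ?thesis by (auto dest: value_not_weak)
  next
    case (weak_AppL s')
    with step show ?thesis by (auto intro: weak.intros)
  next
    case (weak_AppR t'')
    with IH [of t''] show ?thesis by (auto intro: weak.intros)
  qed
qed

text \<open>The diamond closes with exactly one step on each side, so any first step leaves a
  reduction to \<open>s\<close> that is shorter by exactly one. Hence \<open>n\<close> serves as a
  termination measure.\<close>

lemma weak_relpowp_normal_step:
  assumes "(weak ^^ n) t s" "normal weak s" "t \<rightarrow>\<^sub>w t'"
  shows "\<exists>m. n = Suc m \<and> (weak ^^ m) t' s"
  using assms
proof (induction n arbitrary: t t')
  case 0
  then show ?case by (auto simp: normal_def)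
next
  case (Suc n)
  from Suc.prems(1) obtain u where u: "t \<rightarrow>\<^sub>w u" "(weak ^^ n) u s"
    by (blast dest: relpowp_Suc_D2)
  from weak_diamond [OF u(1) Suc.prems(3)] show ?case
  proof
    assume "u = t'"
    with u show ?thesis by blast
  next
    assume "\<exists>c. u \<rightarrow>\<^sub>w c \<and> t' \<rightarrow>\<^sub>w c"
    then obtain c where c: "u \<rightarrow>\<^sub>w c" "t' \<rightarrow>\<^sub>w c" by blast
    from Suc.IH [OF u(2) Suc.prems(2) c(1)] c(2) show ?thesis
      by (blast intro: relpowp_Suc_I2)
  qed
qed

lemma weak_normalizing_imp_strongly_normalizing:
  assumes "weak\<^sup>*\<^sup>* t s" "normal weak s"
  shows "strongly_normalizing weak t"
proof -
  from assms(1) obtain n where "(weak ^^ n) t s"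
    by (blast dest: rtranclp_imp_relpowp)
  then show ?thesis
  proof (induction n arbitrary: t rule: less_induct)
    case (less n)
    show ?case
      unfolding strongly_normalizing_def
    proof
      assume "\<exists>f. f 0 = t \<and> (\<forall>i. f i \<rightarrow>\<^sub>w f (Suc i))"
      then obtain f where f: "f 0 = t" "\<And>i. f i \<rightarrow>\<^sub>w f (Suc i)" by blast
      with weak_relpowp_normal_step [OF less.prems assms(2), of "f 1"]
      obtain m where "n = Suc m" "(weak ^^ m) (f 1) s" "m < n"
        by (metis One_nat_def lessI)
      then have "strongly_normalizing weak (f 1)" using less.IH [of m] by blast
      moreover have "\<exists>g. g 0 = f 1 \<and> (\<forall>i. g i \<rightarrow>\<^sub>w g (Suc i))"
        by (rule exI [of _ "\<lambda>i. f (Suc i)"]) (simp add: f(2))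
      ultimately show False unfolding strongly_normalizing_def by blast
    qed
  qed
qed

text \<open>Since \<open>u\<close> is a value, a redex whose argument is a variable replaced by
  \<open>u\<close> remains a redex.\<close>

lemma weak_subst: "t \<rightarrow>\<^sub>w t' \<Longrightarrow> is_value u \<Longrightarrow> subst k u t \<rightarrow>\<^sub>w subst k u t'"
  by (induction rule: weak.induct) (auto simp: subst_subst is_value_subst intro: weak.intros)

lemma weak_rtranclp_subst:
  "weak\<^sup>*\<^sup>* t t' \<Longrightarrow> is_value u \<Longrightarrow> weak\<^sup>*\<^sup>* (subst k u t) (subst k u t')"
  by (induction rule: rtranclp_induct) (auto intro: weak_subst rtranclp.rtrancl_into_rtrancl)

lemma weak_rtranclp_App:
  assumes "weak\<^sup>*\<^sup>* t t'" "weak\<^sup>*\<^sup>* s s'"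
  shows "weak\<^sup>*\<^sup>* (App t s) (App t' s')"
proof -
  from assms(1) have "weak\<^sup>*\<^sup>* (App t s) (App t' s)"
    by (induction rule: rtranclp_induct) (auto intro: weak.intros rtranclp.rtrancl_into_rtrancl)
  also from assms(2) have "weak\<^sup>*\<^sup>* (App t' s) (App t' s')"
    by (induction rule: rtranclp_induct) (auto intro: weak.intros rtranclp.rtrancl_into_rtrancl)
  finally show ?thesis .
qed

section \<open>Parallel reduction and its steps under abstractions\<close>

inductive par :: "lterm \<Rightarrow> lterm \<Rightarrow> bool" where
  par_Var: "par (Var i) (Var i)"
| par_Lam: "par t t' \<Longrightarrow> par (Lam t) (Lam t')"
| par_App: "par t t' \<Longrightarrow> par s s' \<Longrightarrow> par (App t s) (App t' s')"
| par_beta: "par t t' \<Longrightarrow> par v v' \<Longrightarrow> is_value v \<Longrightarrow> is_value v' \<Longrightarrow>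
    par (App (Lam t) v) (subst 0 v' t')"

text \<open>There is no contraction clause, and the full \<open>par\<close> is allowed only below
  \<open>Lam\<close>: the term keeps its shape outside abstractions.\<close>

inductive internal_par :: "lterm \<Rightarrow> lterm \<Rightarrow> bool" where
  internal_par_Var: "internal_par (Var i) (Var i)"
| internal_par_Lam: "par t t' \<Longrightarrow> internal_par (Lam t) (Lam t')"
| internal_par_App: "internal_par t t' \<Longrightarrow> internal_par s s' \<Longrightarrow>
    internal_par (App t s) (App t' s')"

inductive_cases internal_par_to_LamE: "internal_par t (Lam s)"
inductive_cases internal_par_to_AppE: "internal_par t (App s u)"

lemma par_refl: "par t t"
  by (induction t) (auto intro: par.intros)

lemma betav_imp_par: "t \<rightarrow>\<^sub>\<beta>\<^sub>v s \<Longrightarrow> par t s"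
  by (induction rule: betav.induct) (auto intro: par.intros par_refl)

lemma internal_par_imp_par: "internal_par t s \<Longrightarrow> par t s"
  by (induction rule: internal_par.induct) (auto intro: par.intros)

lemma par_value_imp_internal_par: "par v s \<Longrightarrow> is_value v \<Longrightarrow> internal_par v s"
  by (cases rule: par.cases) (auto intro: internal_par.intros)

lemma internal_par_is_value_iff: "internal_par t s \<Longrightarrow> is_value t \<longleftrightarrow> is_value s"
  by (cases rule: internal_par.cases) auto

lemma par_lift: "par t s \<Longrightarrow> par (lift k t) (lift k s)"
  by (induction arbitrary: k rule: par.induct)
    (auto simp: lift_subst_le is_value_lift intro: par.intros)

lemma par_subst:
  "par t t' \<Longrightarrow> par v v' \<Longrightarrow> is_value v \<Longrightarrow> is_value v' \<Longrightarrow> par (subst k v t) (subst k v' t')"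
  by (induction arbitrary: k v v' rule: par.induct)
    (auto simp: subst_subst is_value_subst is_value_lift par_lift intro: par.intros)

text \<open>An occurrence of the variable outside abstractions exposes the step from
  \<open>v\<close> to \<open>v'\<close>, which must therefore be internal; below an abstraction
  \<open>par_subst\<close> suffices.\<close>

lemma internal_par_subst:
  assumes "internal_par t t'" "internal_par v v'" "is_value v" "is_value v'"
  shows "internal_par (subst k v t) (subst k v' t')"
  using assms(1)
  by (induction rule: internal_par.induct)
    (simp_all add: assms is_value_lift internal_par.intros par_subst par_lift
      internal_par_imp_par)

lemma par_split: "par t s \<Longrightarrow> \<exists>u. weak\<^sup>*\<^sup>* t u \<and> internal_par u s"
proof (induction rule: par.induct)
  case (par_Var i)
  show ?case by (blast intro: internal_par.intros)
next
  case (par_Lam t t')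
  then show ?case by (blast intro: internal_par.intros)
next
  case (par_App t t' s s')
  then show ?case by (blast intro: internal_par.intros weak_rtranclp_App)
next
  case (par_beta t t' v v')
  from par_beta.IH(1) obtain u where u: "weak\<^sup>*\<^sup>* t u" "internal_par u t'" by blast
  \<comment> \<open>The weak steps from \<open>t\<close> to \<open>u\<close> are blocked by the
    abstraction until the root redex is contracted.\<close>
  have "App (Lam t) v \<rightarrow>\<^sub>w subst 0 v t" using par_beta.hyps by (auto intro: weak.intros)
  also have "weak\<^sup>*\<^sup>* (subst 0 v t) (subst 0 v u)"
    using u(1) par_beta.hyps by (auto intro: weak_rtranclp_subst)
  finally have "weak\<^sup>*\<^sup>* (App (Lam t) v) (subst 0 v u)" by simp
  \<comment> \<open>The parallel step from \<open>v\<close> is itself internal because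
    \<open>v\<close> is a value.\<close>
  moreover have "internal_par (subst 0 v u) (subst 0 v' t')"
    using u(2) par_beta.hyps by (auto intro: internal_par_subst par_value_imp_internal_par)
  ultimately show ?case by blast
qed

text \<open>The redex contracted in \<open>u\<close> already has a counterpart in \<open>t\<close>,
  so contracting that one along with the internal redexes is a single parallel step.\<close>

lemma internal_par_weak_imp_par: "u \<rightarrow>\<^sub>w s \<Longrightarrow> internal_par t u \<Longrightarrow> par t s"
proof (induction arbitrary: t rule: weak.induct)
  case (weak_root v a)
  then show ?case
    by (auto elim!: internal_par_to_AppE internal_par_to_LamE
        dest: internal_par_is_value_iff internal_par_imp_par intro: par.intros)
qed (auto elim!: internal_par_to_AppE intro: par.intros internal_par_imp_par)

lemma internal_par_weak_rtranclp_postpone: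
  assumes "weak\<^sup>*\<^sup>* u s" "internal_par t u"
  shows "\<exists>r. weak\<^sup>*\<^sup>* t r \<and> internal_par r s"
  using assms
proof (induction rule: rtranclp_induct)
  case base
  then show ?case by blast
next
  case (step s s')
  then obtain r where "weak\<^sup>*\<^sup>* t r" "internal_par r s" by blast
  \<comment> \<open>The internal step and the next weak step merge into one parallel step, which is
    split again with its weak part first.\<close>
  moreover obtain r' where "weak\<^sup>*\<^sup>* r r'" "internal_par r' s'"
    using internal_par_weak_imp_par [OF step.hyps(2) \<open>internal_par r s\<close>] par_split by blast
  ultimately show ?case by (blast intro: rtranclp_trans)
qed

text \<open>An internal step preserves applications, abstractions and values outside abstractions,
  so every weak redex of \<open>t\<close> survives in \<open>s\<close>.\<close>

lemma weak_internal_par: "t \<rightarrow>\<^sub>w t' \<Longrightarrow> internal_par t s \<Longrightarrow> \<exists>s'. s \<rightarrow>\<^sub>w s'"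
proof (induction arbitrary: s rule: weak.induct)
  case (weak_root v t)
  then show ?case
    by (auto elim!: internal_par.cases [of "App _ _"] internal_par.cases [of "Lam _"]
        dest: internal_par_is_value_iff intro: weak.intros)
qed (auto elim!: internal_par.cases [of "App _ _"] intro: weak.intros; blast intro: weak.intros)+

lemma betav_weak_normalizing:
  assumes "t \<rightarrow>\<^sub>\<beta>\<^sub>v s" "weak\<^sup>*\<^sup>* s n" "normal weak n"
  shows "\<exists>m. weak\<^sup>*\<^sup>* t m \<and> normal weak m"
proof -
  from par_split [OF betav_imp_par [OF assms(1)]]
  obtain u where u: "weak\<^sup>*\<^sup>* t u" "internal_par u s" by blast
  from internal_par_weak_rtranclp_postpone [OF assms(2) u(2)]
  obtain m where m: "weak\<^sup>*\<^sup>* u m" "internal_par m n" by blast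
  from m(2) assms(3) have "normal weak m"
    unfolding normal_def by (blast dest: weak_internal_par)
  with u(1) m(1) show ?thesis by (blast intro: rtranclp_trans)
qed

theorem theorem6:
  fixes t s :: lterm
  assumes "betav\<^sup>*\<^sup>* t s"
    and "normal weak s"
  shows "strongly_normalizing weak t"
proof -
  \<comment> \<open>What is carried backwards from \<open>s\<close> is the existence of a weak
    normal form; strong normalization is derived only at the end.\<close>
  from assms have "\<exists>n. weak\<^sup>*\<^sup>* t n \<and> normal weak n"
    by (induction rule: converse_rtranclp_induct) (blast intro: betav_weak_normalizing)+
  then show ?thesis by (blast intro: weak_normalizing_imp_strongly_normalizing)
qed

end
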